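(* Let $P$ be a $2\times n$ transportation polytope. For every cost vector $s\in\mathbb{R}^{2\times n}$ and every vertex $y^O$ of $P$ there is an edge walk in the graph of $P$ of length at most $n$ from $y^O$ to a vertex $y^F$ maximizing $s^Ty$ over $P$, along which the values $s^Ty$ of the visited vertices are nondecreasing (in particular the graph diameter of $P$ is at most $n$). Moreover this bound is tight: for every $n\geq 3$ there is a $2\times n$ transportation polytope whose graph diameter equals $n$.
   Context: For $u\in\mathbb{R}^2_{>0}$, $v\in\mathbb{R}^n_{>0}$ with $u_1+u_2=\sum_j v_j$, the $2\times n$ transportation polytope is $P=\{y\in\mathbb{R}^{2\times n}: \sum_{j} y_{ij}=u_i\ (i=1,2),\ \sum_{i} y_{ij}=v_j\ (j\in[n]),\ y\geq 0\}$. The graph of $P$ is its $1$-skeleton (vertices and edges of $P$); an edge walk is a path in this graph and its length is the number of edges used; the graph diameter is the maximum over pairs of vertices of the graph distance. *)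

theory Defs
  imports "HOL-Analysis.Analysis" "HOL-Library.Extended_Nat"
begin

definition transportation_polytope :: "real^2 \<Rightarrow> real^'n \<Rightarrow> (real^'n^2) set" where
  "transportation_polytope u v =
     {y. (\<forall>i. (\<Sum>j\<in>UNIV. y $ i $ j) = u $ i) \<and>
         (\<forall>j. (\<Sum>i\<in>UNIV. y $ i $ j) = v $ j) \<and>
         (\<forall>i j. 0 \<le> y $ i $ j)}"

definition is_transportation_polytope :: "(real^'n^2) set \<Rightarrow> bool" where
  "is_transportation_polytope P \<longleftrightarrow>
     (\<exists>u v. (\<forall>i. 0 < u $ i) \<and> (\<forall>j. 0 < v $ j) \<and>
            u $ 1 + u $ 2 = (\<Sum>j\<in>UNIV. v $ j) \<and>
            P = transportation_polytope u v)"

definition skeleton_adj :: "'a::euclidean_space set \<Rightarrow> 'a \<Rightarrow> 'a \<Rightarrow> bool" where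
  "skeleton_adj P x y \<longleftrightarrow> closed_segment x y edge_of P"

text \<open>A walk is the list of its visited vertices. Following the usual meaning of a path in a
  graph, no vertex is repeated; the one-element list is the path of length 0.\<close>

definition edge_walk :: "'a::euclidean_space set \<Rightarrow> 'a list \<Rightarrow> bool" where
  "edge_walk P xs \<longleftrightarrow>
     xs \<noteq> [] \<and> distinct xs \<and> (\<forall>x\<in>set xs. x extreme_point_of P) \<and>
     successively (skeleton_adj P) xs"

definition walk_length :: "'a list \<Rightarrow> nat" where
  "walk_length xs = length xs - 1"

text \<open>Values in \<open>enat\<close>: the distance of two vertices not joined by any walk is
  \<open>\<infinity>\<close>, so a finite diameter includes connectedness.\<close>

definition graph_dist :: "'a::euclidean_space set \<Rightarrow> 'a \<Rightarrow> 'a \<Rightarrow> enat" where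
  "graph_dist P x y =
     (INF xs\<in>{xs. edge_walk P xs \<and> hd xs = x \<and> last xs = y}. enat (walk_length xs))"

definition graph_diameter :: "'a::euclidean_space set \<Rightarrow> enat" where
  "graph_diameter P =
     (SUP (x, y)\<in>{x. x extreme_point_of P} \<times> {y. y extreme_point_of P}. graph_dist P x y)"

end

theory Submission
  imports Defs
begin

text \<open>A point of the polytope is determined by its first row, so the polytope is a slice of a box: its
  vertices have at most one fractional column (both entries positive), and its edges exchange mass
  between two columns, one of which is the fractional one if it exists. Given an optimal vertex \<open>z\<close>
  with break column \<open>k\<close>, all other columns of \<open>z\<close> sit at a bound. Exchanges between columns that are
  wrong in opposite ways are improving and repair one column for good, and at most one further
  pivot, which leaves \<open>k\<close>, is needed. Since each of the \<open>n - 1\<close> other columns is repaired at most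
  once, at most \<open>n\<close> steps suffice. The diameter bound is the case \<open>s = 0\<close>.

  For tightness take a non-degenerate instance with two vertices that are fractional in a narrow
  column \<open>k\<close> and sit at opposite bounds everywhere else: each of the \<open>n - 1\<close> columns costs a step, and
  as \<open>k\<close> cannot absorb any of the switches, it must be left and re-entered.\<close>

section \<open>Exchanges between two columns\<close>

text \<open>All row and column sums of this matrix vanish: row \<open>i\<close> shifts a unit from
  column \<open>a\<close> to column \<open>b\<close>, and the other row compensates.\<close>

definition pivot_dir :: "2 \<Rightarrow> 'n \<Rightarrow> 'n \<Rightarrow> real^'n::finite^2" where
  "pivot_dir i a b = (\<chi> r j. (if r = i then 1 else -1) * (of_bool (j = b) - of_bool (j = a)))"

lemma pivot_dir_nth:
  "pivot_dir i a b $ r $ j = (if r = i then 1 else -1) * (of_bool (j = b) - of_bool (j = a))"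
  by (simp add: pivot_dir_def)

lemma one_neq_two: "(1 :: 2) \<noteq> 2"
  by simp

lemma other_row: "i \<noteq> i' \<Longrightarrow> r = i \<or> r = i'" for i i' r :: 2
  using exhaust_2[of i] exhaust_2[of i'] exhaust_2[of r] by auto

lemma sum_rows: "i \<noteq> i' \<Longrightarrow> (\<Sum>r\<in>UNIV. f r) = f i + f i'" for i i' :: 2 and f :: "2 \<Rightarrow> real"
  using exhaust_2[of i] exhaust_2[of i'] by (auto simp: sum_2)

text \<open>The gain of a unit exchange is the difference of the reduced costs
  \<open>s$i'$j - s$i$j\<close> of the two columns, so comparing these numbers decides whether an
  exchange improves.\<close>

lemma inner_pivot_dir:
  fixes s :: "real^'n::finite^2"
  assumes "i \<noteq> i'"
  shows "s \<bullet> pivot_dir i a b = (s$i'$a - s$i$a) - (s$i'$b - s$i$b)"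
proof -
  have delta: "(\<Sum>j\<in>UNIV. f j * of_bool (j = c)) = f c" for f :: "'n \<Rightarrow> real" and c
    by (subst sum.remove[of _ c]) auto
  show ?thesis
    using assms
    by (simp add: inner_vec_def pivot_dir_nth sum_rows[OF assms] right_diff_distrib sum_subtractf
        sum_negf delta)
qed

lemma pivot_dir_swap: "- pivot_dir i a b = pivot_dir i b a"
  by (simp add: vec_eq_iff pivot_dir_nth)

definition fractional :: "real^'n::finite^2 \<Rightarrow> 'n \<Rightarrow> bool" where
  "fractional y j \<longleftrightarrow> (\<forall>i. 0 < y$i$j)"

lemma fractional_rows: "i \<noteq> i' \<Longrightarrow> fractional y j \<longleftrightarrow> 0 < y$i$j \<and> 0 < y$i'$j"
  unfolding fractional_def using other_row by metis

section \<open>Coordinates, convexity and compactness of the polytope\<close>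

locale transport =
  fixes u :: "real^2" and v :: "real^'n::finite"
  assumes u_pos: "0 < u$i" and v_pos: "0 < v$j"
begin

abbreviation P where "P \<equiv> transportation_polytope u v"

lemma P_row: "y \<in> P \<Longrightarrow> (\<Sum>j\<in>UNIV. y$i$j) = u$i"
  and P_nonneg: "y \<in> P \<Longrightarrow> 0 \<le> y$i$j"
  by (auto simp: transportation_polytope_def)

lemma P_col: "y \<in> P \<Longrightarrow> i \<noteq> i' \<Longrightarrow> y$i$j + y$i'$j = v$j"
  by (auto simp: transportation_polytope_def sum_rows)

lemma P_I:
  assumes "\<And>i. (\<Sum>j\<in>UNIV. y$i$j) = u$i" "\<And>j. y$1$j + y$2$j = v$j" "\<And>i j. 0 \<le> y$i$j"
  shows "y \<in> P"
  using assms by (auto simp: transportation_polytope_def sum_2)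

lemma not_fractional: "y \<in> P \<Longrightarrow> i \<noteq> i' \<Longrightarrow> \<not> fractional y j \<longleftrightarrow> y$i$j = 0 \<or> y$i'$j = 0"
  by (metis P_nonneg fractional_rows less_eq_real_def less_irrefl)

text \<open>The sum of row \<open>i\<close> forces the entry in column \<open>k\<close>, and the
  column sums then force the other row.\<close>

lemma P_eqI:
  assumes "x \<in> P" "y \<in> P" "\<And>j. j \<noteq> k \<Longrightarrow> x$i$j = y$i$j"
  shows "x = y"
proof -
  have "(\<Sum>j\<in>UNIV. x$i$j) = (\<Sum>j\<in>UNIV. y$i$j)"
    using assms P_row by simp
  moreover have "(\<Sum>j\<in>UNIV - {k}. x$i$j) = (\<Sum>j\<in>UNIV - {k}. y$i$j)"
    using assms by (intro sum.cong) auto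
  ultimately have "x$i$k = y$i$k"
    by (simp add: sum.remove[of UNIV k])
  then have eq: "x$i$j = y$i$j" for j using assms by metis
  have "x$r$j = y$r$j" for r j
  proof (cases "r = i")
    case False
    then show ?thesis using P_col[OF assms(1), of i r j] P_col[OF assms(2), of i r j] eq[of j] by simp
  qed (use eq in simp)
  then show ?thesis by (simp add: vec_eq_iff)
qed

lemma convex_P: "convex P"
  unfolding convex_def
proof (intro ballI allI impI P_I)
  fix x y and \<alpha> \<beta> :: real
  assume *: "x \<in> P" "y \<in> P" "0 \<le> \<alpha>" "0 \<le> \<beta>" "\<alpha> + \<beta> = 1"
  show "(\<Sum>j\<in>UNIV. (\<alpha> *\<^sub>R x + \<beta> *\<^sub>R y)$i$j) = u$i" for i
    using * by (simp add: sum.distrib flip: sum_distrib_left)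
      (simp add: P_row flip: distrib_right)
  show "(\<alpha> *\<^sub>R x + \<beta> *\<^sub>R y)$1$j + (\<alpha> *\<^sub>R x + \<beta> *\<^sub>R y)$2$j = v$j" for j
  proof -
    have "(\<alpha> *\<^sub>R x + \<beta> *\<^sub>R y)$1$j + (\<alpha> *\<^sub>R x + \<beta> *\<^sub>R y)$2$j
        = \<alpha> * (x$1$j + x$2$j) + \<beta> * (y$1$j + y$2$j)" by (simp add: algebra_simps)
    also have "\<dots> = v$j" using * by (simp add: P_col flip: distrib_right)
    finally show ?thesis .
  qed
  show "0 \<le> (\<alpha> *\<^sub>R x + \<beta> *\<^sub>R y)$i$j" for i j
    using * by (simp add: P_nonneg)
qed

text \<open>Every entry is at most its column sum, which bounds the norm. Here and below,
  \<open>i + 1\<close> in the type \<open>2\<close> is the row other than \<open>i\<close>.\<close>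

lemma compact_P: "compact P"
proof -
  have "closed P"
    unfolding transportation_polytope_def
    by (intro closed_Collect_conj closed_Collect_all closed_Collect_eq closed_Collect_le
        continuous_intros)
  moreover have "norm y \<le> (\<Sum>i\<in>(UNIV :: 2 set). \<Sum>j\<in>UNIV. v$j)" if "y \<in> P" for y
  proof -
    have "norm (y$i$j) \<le> v$j" for i j
      using P_col[OF that, of i "i+1" j] P_nonneg[OF that, of i j] P_nonneg[OF that, of "i+1" j]
      by simp
    then have "norm (y$i) \<le> (\<Sum>j\<in>UNIV. v$j)" for i
      by (intro order_trans[OF norm_le_l1_cart] sum_mono) simp
    then show ?thesis
      unfolding norm_vec_def[of y]
      by (intro order_trans[OF L2_set_le_sum] sum_mono) auto
  qed
  ultimately show ?thesis
    unfolding compact_eq_bounded_closed bounded_iff by blast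
qed

text \<open>Only the entries at \<open>(i, a)\<close> and \<open>(i', b)\<close> decrease, so they
  alone limit the step.\<close>

lemma pivot_in_P:
  assumes "y \<in> P" "i \<noteq> i'" "a \<noteq> b" "0 \<le> t" "t \<le> y$i$a" "t \<le> y$i'$b"
  shows "y + t *\<^sub>R pivot_dir i a b \<in> P"
proof (rule P_I)
  show "(\<Sum>j\<in>UNIV. (y + t *\<^sub>R pivot_dir i a b)$r$j) = u$r" for r
    using assms(1)
    by (simp add: sum.distrib P_row flip: sum_distrib_left)
      (simp add: pivot_dir_nth sum_subtractf sum_negf of_bool_def flip: sum_distrib_left)
  show "(y + t *\<^sub>R pivot_dir i a b)$1$j + (y + t *\<^sub>R pivot_dir i a b)$2$j = v$j" for j
    using P_col[OF assms(1), of 1 2 j] exhaust_2[of i] by (auto simp: pivot_dir_nth)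
  show "0 \<le> (y + t *\<^sub>R pivot_dir i a b)$r$j" for r j
    using assms P_nonneg[OF assms(1), of r j] other_row[OF assms(2), of r]
    by (auto simp: pivot_dir_nth)
qed

section \<open>Vertices and edges\<close>

lemma vertex_in_P: "x extreme_point_of P \<Longrightarrow> x \<in> P"
  by (simp add: extreme_point_of_def)

lemma open_segment_zero:
  fixes p q :: "real^'n^2"
  assumes "x \<in> open_segment p q" "p \<in> P" "q \<in> P" "x$i$j = 0"
  shows "p$i$j = 0 \<and> q$i$j = 0"
proof -
  obtain t where t: "0 < t" "t < 1" "x = (1 - t) *\<^sub>R p + t *\<^sub>R q"
    using assms(1) by (auto simp: in_segment)
  then have "(1 - t) * p$i$j + t * q$i$j = 0" using assms(4) by simp
  moreover have "0 \<le> (1 - t) * p$i$j" "0 \<le> t * q$i$j"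
    using t P_nonneg assms by auto
  ultimately have "(1 - t) * p$i$j = 0" "t * q$i$j = 0" by linarith+
  then show ?thesis using t by simp
qed

text \<open>A non-fractional column has a zero entry; both endpoints share it by nonnegativity, and
  the column sum fixes the other entry.\<close>

lemma open_segment_eq:
  assumes "x \<in> open_segment p q" "p \<in> P" "q \<in> P" "x \<in> P" "\<not> fractional x j"
  shows "p$i$j = x$i$j \<and> q$i$j = x$i$j"
proof -
  obtain r where "x$r$j = 0"
    using assms not_fractional[of x 1 2 j] by auto
  with open_segment_zero[OF assms(1-3) this] show ?thesis
    using P_col[OF assms(2), of r i j] P_col[OF assms(3), of r i j] P_col[OF assms(4), of r i j]
    by (cases "r = i") auto
qed

text \<open>All four entries of the two columns are positive, so the exchange can be carried out in
  both directions; their minimum is a step length valid for both.\<close>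

lemma pivot_open_segment:
  assumes "y \<in> P" "a \<noteq> b" "fractional y a" "fractional y b"
  obtains t where "0 < t" "y + t *\<^sub>R pivot_dir 1 a b \<in> P" "y - t *\<^sub>R pivot_dir 1 a b \<in> P"
    "y \<in> open_segment (y + t *\<^sub>R pivot_dir 1 a b) (y - t *\<^sub>R pivot_dir 1 a b)"
proof -
  define t where "t = Min {y$1$a, y$2$a, y$1$b, y$2$b}"
  have t: "0 < t" using assms by (simp add: t_def fractional_def)
  have le: "t \<le> y$1$a" "t \<le> y$2$a" "t \<le> y$1$b" "t \<le> y$2$b" by (auto simp: t_def)
  have 1: "y + t *\<^sub>R pivot_dir 1 a b \<in> P"
    using pivot_in_P[OF assms(1), of 1 2 a b t] assms(2) t le by simp
  have 2: "y - t *\<^sub>R pivot_dir 1 a b \<in> P"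
    using pivot_in_P[OF assms(1), of 1 2 b a t] assms(2) t le
    by (simp flip: pivot_dir_swap[of 1 a b])
  have "pivot_dir 1 a b $ 1 $ b = 1" using assms(2) by (simp add: pivot_dir_nth)
  then have "t *\<^sub>R pivot_dir 1 a b \<noteq> 0" using t by auto
  moreover have "y = midpoint (y + t *\<^sub>R pivot_dir 1 a b) (y - t *\<^sub>R pivot_dir 1 a b)"
    by (simp add: midpoint_def flip: scaleR_2)
  moreover have "y + w \<noteq> y - w" if "w \<noteq> 0" for w :: "real^'n^2"
    using that by (simp add: eq_diff_eq add.assoc flip: scaleR_2)
  ultimately have "y \<in> open_segment (y + t *\<^sub>R pivot_dir 1 a b) (y - t *\<^sub>R pivot_dir 1 a b)"
    by (metis midpoint_in_open_segment)
  with t 1 2 show ?thesis by (rule that)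
qed

text \<open>Two fractional columns admit a two-way exchange. Conversely, if all columns but one are
  non-fractional, a segment with \<open>x\<close> in its interior is constant on them, and
  \<open>P_eqI\<close> makes its endpoints equal.\<close>

lemma vertex_iff:
  "x extreme_point_of P \<longleftrightarrow> x \<in> P \<and> (\<forall>a b. fractional x a \<longrightarrow> fractional x b \<longrightarrow> a = b)"
proof (intro iffI conjI allI impI)
  assume x: "x extreme_point_of P"
  then show "x \<in> P" by (rule vertex_in_P)
  fix a b assume "fractional x a" "fractional x b"
  then show "a = b"
    using x pivot_open_segment[OF \<open>x \<in> P\<close>, of a b] unfolding extreme_point_of_def by metis
next
  assume *: "x \<in> P \<and> (\<forall>a b. fractional x a \<longrightarrow> fractional x b \<longrightarrow> a = b)"
  then obtain k where k: "\<And>j. j \<noteq> k \<Longrightarrow> \<not> fractional x j" by metis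
  have "x \<notin> open_segment p q" if "p \<in> P" "q \<in> P" for p q
  proof
    assume x: "x \<in> open_segment p q"
    have "p = q"
      using open_segment_eq[OF x that] * k by (intro P_eqI[OF that, of k 1]) metis
    then show False using x by simp
  qed
  with * show "x extreme_point_of P" by (simp add: extreme_point_of_def)
qed

lemma vertexE:
  assumes "x extreme_point_of P"
  obtains k where "\<And>j. j \<noteq> k \<Longrightarrow> \<not> fractional x j"
  using assms unfolding vertex_iff by metis

text \<open>The points of \<open>P\<close> that agree with \<open>x\<close> off the columns \<open>a\<close>, \<open>b\<close> lie on one line, so
  extremality of \<open>x\<close> and \<open>x'\<close> cuts this face down to the segment between them.\<close>

lemma skeleton_adjI:
  assumes x: "x extreme_point_of P" and x': "x' extreme_point_of P" and "x \<noteq> x'"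
    and eq: "\<And>j. j \<noteq> a \<Longrightarrow> j \<noteq> b \<Longrightarrow> \<not> fractional x j \<and> x'$1$j = x$1$j"
  shows "skeleton_adj P x x'"
proof -
  define F where "F = {y \<in> P. \<forall>j. j \<noteq> a \<longrightarrow> j \<noteq> b \<longrightarrow> y$1$j = x$1$j}"
  have P: "x \<in> P" "x' \<in> P" using x x' vertex_in_P by auto
  have xa: "x'$1$a \<noteq> x$1$a"
    using P_eqI[OF P, of b 1] eq \<open>x \<noteq> x'\<close> by metis
  have "F = closed_segment x x'"
  proof (intro set_eqI iffI)
    fix y assume y: "y \<in> F"
    then have yP: "y \<in> P" by (simp add: F_def)
    \<comment> \<open>Column \<open>a\<close> distinguishes \<open>x\<close> from \<open>x'\<close>,
      so it supplies the parameter of \<open>y\<close> on the line through them; the row sum then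
      settles column \<open>b\<close>.\<close>
    define t where "t = (y$1$a - x$1$a) / (x'$1$a - x$1$a)"
    have ya: "y$1$a = x$1$a + t * (x'$1$a - x$1$a)" using xa by (simp add: t_def)
    have y1: "y$1$j = x$1$j + t * (x'$1$j - x$1$j)" if "j \<noteq> b" for j
      using ya eq[of j] y that by (cases "j = a") (auto simp: F_def)
    have row: "(\<Sum>j\<in>UNIV. w$1$j) = w$1$b + (\<Sum>j\<in>UNIV - {b}. w$1$j)" for w :: "real^'n^2"
      by (simp add: sum.remove[of UNIV b])
    have "(\<Sum>j\<in>UNIV - {b}. y$1$j)
        = (\<Sum>j\<in>UNIV - {b}. x$1$j) + t * ((\<Sum>j\<in>UNIV - {b}. x'$1$j) - (\<Sum>j\<in>UNIV - {b}. x$1$j))"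
      using y1 by (simp add: sum.distrib sum_distrib_left flip: sum_subtractf)
    moreover have "(\<Sum>j\<in>UNIV - {b}. w$1$j) = u$1 - w$1$b" if "w \<in> P" for w
      using row[of w] P_row[OF that, of 1] by simp
    ultimately have "y$1$b = x$1$b + t * (x'$1$b - x$1$b)"
      using P yP by (simp add: algebra_simps)
    then have y1: "y$1$j = x$1$j + t * (x'$1$j - x$1$j)" for j using y1 by metis
    have "y$2$j = x$2$j + t * (x'$2$j - x$2$j)" for j
    proof -
      have eqs: "y$2$j = v$j - y$1$j" "x$2$j = v$j - x$1$j" "x'$2$j = v$j - x'$1$j"
        using P_col[OF P(1), of 1 2 j] P_col[OF P(2), of 1 2 j] P_col[OF yP, of 1 2 j] by simp_all
      then show ?thesis unfolding eqs y1[of j] by (simp add: algebra_simps)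
    qed
    then have yt: "y = x + t *\<^sub>R (x' - x)"
      using y1 by (simp add: vec_eq_iff forall_2)
    \<comment> \<open>Were \<open>t\<close> negative, \<open>x\<close> would lie strictly between
      \<open>y\<close> and \<open>x'\<close>, with weight \<open>- t / (1 - t)\<close> on
      \<open>x'\<close>.\<close>
    have "0 \<le> t"
    proof (rule ccontr)
      assume "\<not> 0 \<le> t"
      then have "0 < 1 - t" and t01: "- t / (1 - t) < 1" "0 < - t / (1 - t)"
        by (auto simp: divide_simps)
      have "(1 - t) *\<^sub>R x = y + (-t) *\<^sub>R x'" by (simp add: yt algebra_simps)
      then have "x = (1 / (1 - t)) *\<^sub>R (y + (-t) *\<^sub>R x')"
        using \<open>0 < 1 - t\<close> by (metis divide_self_if less_irrefl scaleR_one scaleR_scaleR times_divide_eq_left mult_1)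
      moreover have "1 - (- t / (1 - t)) = 1 / (1 - t)"
        using \<open>0 < 1 - t\<close> by (simp add: field_simps)
      ultimately have "x = (1 - (- t / (1 - t))) *\<^sub>R y + (- t / (1 - t)) *\<^sub>R x'"
        by (simp add: scaleR_diff_right)
      moreover have "y$1$a \<noteq> x'$1$a"
      proof
        assume "y$1$a = x'$1$a"
        then have "(t - 1) * (x'$1$a - x$1$a) = 0" using ya by (simp add: algebra_simps)
        then show False using xa \<open>\<not> 0 \<le> t\<close> by simp
      qed
      then have "y \<noteq> x'" by auto
      ultimately have "x \<in> open_segment y x'"
        using t01 unfolding in_segment by blast
      then show False using x yP P unfolding extreme_point_of_def by blast
    qed
    moreover have "t \<le> 1"
    proof (rule ccontr)
      assume "\<not> t \<le> 1"
      then have "0 < t" "1 / t < 1" "0 < 1 / t" by (auto simp: divide_simps)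
      moreover have "x' = (1 - 1 / t) *\<^sub>R x + (1 / t) *\<^sub>R y"
        using \<open>0 < t\<close> by (simp add: yt algebra_simps)
      moreover have "x \<noteq> y"
        using yt xa \<open>0 < t\<close> ya by auto
      ultimately have "x' \<in> open_segment x y"
        unfolding in_segment by blast
      then show False using x' yP P unfolding extreme_point_of_def by blast
    qed
    ultimately show "y \<in> closed_segment x x'"
      unfolding in_segment yt by (auto intro!: exI[of _ t] simp: algebra_simps)
  next
    fix y assume y: "y \<in> closed_segment x x'"
    then have "y \<in> P" using closed_segment_subset[OF P convex_P] by auto
    moreover obtain t where "y = (1 - t) *\<^sub>R x + t *\<^sub>R x'" using y by (auto simp: in_segment)
    ultimately show "y \<in> F"
      using eq by (simp add: F_def) (simp add: algebra_simps)
  qed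
  moreover have "F face_of P"
    unfolding face_of_def
  proof (intro conjI ballI impI)
    show "F \<subseteq> P" by (auto simp: F_def)
    show "convex F" using \<open>F = closed_segment x x'\<close> by simp
    fix p q y assume *: "p \<in> P" "q \<in> P" "y \<in> F" "y \<in> open_segment p q"
    have y: "y \<in> P" "\<And>j. j \<noteq> a \<Longrightarrow> j \<noteq> b \<Longrightarrow> y$1$j = x$1$j" using * by (auto simp: F_def)
    \<comment> \<open>Off \<open>a\<close> and \<open>b\<close> the point \<open>y\<close> has the
      non-fractional columns of \<open>x\<close>, so a segment of \<open>P\<close> with
      \<open>y\<close> in its interior is constant there.\<close>
    have "\<not> fractional y j" if "j \<noteq> a" "j \<noteq> b" for j
      using eq[OF that] y(2)[OF that] P_col[OF P(1) one_neq_two, of j]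
        P_col[OF y(1) one_neq_two, of j]
      unfolding fractional_def forall_2 by (metis add_left_cancel)
    then show "p \<in> F" "q \<in> F"
      using open_segment_eq[OF *(4,1,2) y(1)] * y by (auto simp: F_def)
  qed
  moreover have "aff_dim (closed_segment x x') = 1"
    using \<open>x \<noteq> x'\<close> by (simp add: segment_convex_hull aff_dim_convex_hull aff_dim_2)
  ultimately show ?thesis by (simp add: skeleton_adj_def edge_of_def)
qed


section \<open>Pivot steps and optimality conditions\<close>

text \<open>The longest feasible step empties one of the two decreasing entries. Then at most one of
  \<open>a\<close>, \<open>b\<close> is still fractional, so the end point is again a vertex, and it
  differs from \<open>x\<close> in these two columns only.\<close>

lemma pivot:
  assumes x: "x extreme_point_of P" and "i \<noteq> i'" "a \<noteq> b" "0 < x$i$a" "0 < x$i'$b"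
    and nf: "\<And>j. j \<noteq> a \<Longrightarrow> j \<noteq> b \<Longrightarrow> \<not> fractional x j"
  obtains x' t where "x' extreme_point_of P" "skeleton_adj P x x'"
    "0 < t" "x' = x + t *\<^sub>R pivot_dir i a b"
    "\<And>j r. j \<noteq> a \<Longrightarrow> j \<noteq> b \<Longrightarrow> x'$r$j = x$r$j"
    "x'$i$a = 0 \<or> x'$i'$b = 0"
proof -
  define t where "t = min (x$i$a) (x$i'$b)"
  define x' where "x' = x + t *\<^sub>R pivot_dir i a b"
  have t: "0 < t" "t \<le> x$i$a" "t \<le> x$i'$b" using assms by (auto simp: t_def)
  have xP: "x \<in> P" using x by (rule vertex_in_P)
  then have x'P: "x' \<in> P"
    unfolding x'_def using assms t by (intro pivot_in_P) auto
  have off: "x'$r$j = x$r$j" if "j \<noteq> a" "j \<noteq> b" for r j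
    using that by (simp add: x'_def pivot_dir_nth)
  have ia: "x'$i$a = x$i$a - t" and ib: "x'$i'$b = x$i'$b - t"
    using assms by (auto simp: x'_def pivot_dir_nth)
  have zero: "x'$i$a = 0 \<or> x'$i'$b = 0"
    unfolding ia ib t_def by auto
  have "\<not> fractional x' j" if "j \<noteq> a" "j \<noteq> b" for j
    using nf[OF that] off[OF that] by (simp add: fractional_def)
  moreover have "\<not> fractional x' a \<or> \<not> fractional x' b"
    using zero not_fractional[OF x'P \<open>i \<noteq> i'\<close>] by metis
  ultimately have x': "x' extreme_point_of P"
    unfolding vertex_iff using x'P by metis
  have "x \<noteq> x'" using ia t by auto
  then have "skeleton_adj P x x'"
    using x x' nf off by (intro skeleton_adjI[of x x' a b]) auto
  with x' t(1) x'_def off show ?thesis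
    using ia ib zero t by (intro that[of x' t]) auto
qed

text \<open>Otherwise a small exchange along \<open>pivot_dir i a b\<close>, feasible because both
  decreasing entries are positive, would raise the objective.\<close>

lemma maximum_reduced_cost:
  assumes z: "is_arg_max (\<lambda>y. s \<bullet> y) (\<lambda>y. y \<in> P) z"
    and "i \<noteq> i'" "0 < z$i$a" "0 < z$i'$b"
  shows "s$i'$a - s$i$a \<le> s$i'$b - s$i$b"
proof (cases "a = b")
  case False
  define t where "t = min (z$i$a) (z$i'$b)"
  have t: "0 < t" "t \<le> z$i$a" "t \<le> z$i'$b" using assms by (auto simp: t_def)
  have "z \<in> P" using z by (simp add: is_arg_max_def)
  then have "z + t *\<^sub>R pivot_dir i a b \<in> P"
    using assms False t by (intro pivot_in_P) auto
  then have "\<not> s \<bullet> z < s \<bullet> (z + t *\<^sub>R pivot_dir i a b)"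
    using z by (auto simp: is_arg_max_def)
  then have "t * (s \<bullet> pivot_dir i a b) \<le> 0" by (simp add: inner_add_right)
  then have "s \<bullet> pivot_dir i a b \<le> 0" using t(1) by (simp add: mult_le_0_iff)
  then show ?thesis unfolding inner_pivot_dir[OF \<open>i \<noteq> i'\<close>] by simp
qed simp

text \<open>The column \<open>k\<close> is the break point of the greedy solution: it separates the columns served
  from row 2 only from those served from row 1 only in the order of the reduced costs.\<close>

lemma break_column:
  assumes z: "z extreme_point_of P" and max: "is_arg_max (\<lambda>y. s \<bullet> y) (\<lambda>y. y \<in> P) z"
  obtains k where "\<And>j. j \<noteq> k \<Longrightarrow> \<not> fractional z j"
    "\<And>i i' a. i \<noteq> i' \<Longrightarrow> z$i$a = 0 \<Longrightarrow> s$i'$k - s$i$k \<le> s$i'$a - s$i$a"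
proof -
  have zP: "z \<in> P" using z by (rule vertex_in_P)
  have pos: "0 < z$i'$a" if "i \<noteq> i'" "z$i$a = 0" for i i' a
    using P_col[OF zP that(1), of a] v_pos[of a] that by simp
  obtain k where k: "\<And>j. j \<noteq> k \<Longrightarrow> \<not> fractional z j"
    using z by (rule vertexE) blast
  show ?thesis
  proof (cases "fractional z k")
    case True
    have "s$i'$k - s$i$k \<le> s$i'$a - s$i$a" if "i \<noteq> i'" "z$i$a = 0" for i i' a
      using maximum_reduced_cost[OF max, of i i' k a] True that pos[OF that]
      by (simp add: fractional_def)
    with k show ?thesis by (rule that)
  next
    case False
    with k have nf: "\<not> fractional z j" for j by metis
    \<comment> \<open>With no fractional column, \<open>k\<close> is the column served from row 1
      with least \<open>s$1$j - s$2$j\<close>. Minimality settles the comparison with columns served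
      from row 1, and \<open>maximum_reduced_cost\<close> the one with columns served from row
      2.\<close>
    define U where "U = {j. 0 < z$1$j}"
    have "U \<noteq> {}"
    proof
      assume "U = {}"
      then have "\<forall>j. z$1$j = 0" using P_nonneg[OF zP] by (auto simp: U_def less_le)
      then show False using P_row[OF zP, of 1] u_pos[of 1] by simp
    qed
    define m where "m = arg_min_on (\<lambda>j. s$1$j - s$2$j) U"
    have m: "m \<in> U" "\<And>a. a \<in> U \<Longrightarrow> s$1$m - s$2$m \<le> s$1$a - s$2$a"
      using arg_min_if_finite(1)[of U "\<lambda>j. s$1$j - s$2$j"]
        arg_min_least[of U _ "\<lambda>j. s$1$j - s$2$j"] \<open>U \<noteq> {}\<close>
      by (auto simp: m_def)
    have "s$i'$m - s$i$m \<le> s$i'$a - s$i$a" if "i \<noteq> i'" "z$i$a = 0" for i i' a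
    proof (cases "i = 1")
      case True
      then show ?thesis
        using maximum_reduced_cost[OF max, of i i' m a] that pos[OF that] m(1) by (simp add: U_def)
    next
      case False
      then have "i = 2" "i' = 1" using that exhaust_2[of i] exhaust_2[of i'] by auto
      then show ?thesis using m(2)[of a] pos[OF that] by (simp add: U_def)
    qed
    with nf show ?thesis by (intro that[of m]) auto
  qed
qed

end

section \<open>Monotone pivots towards a fixed optimal vertex\<close>

text \<open>Optimality of \<open>z\<close> is encoded as a comparison of every column with the
  single column \<open>k\<close>. Chaining two comparisons through \<open>k\<close> shows that an
  exchange between oppositely bad columns does not lower the objective.\<close>

locale transport_target = transport u v
  for u :: "real^2" and v :: "real^'n::finite" +
  fixes s z :: "real^'n^2" and k :: 'n
  assumes z: "z extreme_point_of P"
    and z_nf: "j \<noteq> k \<Longrightarrow> \<not> fractional z j"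
    and z_opt: "i \<noteq> i' \<Longrightarrow> z$i$a = 0 \<Longrightarrow> s$i'$k - s$i$k \<le> s$i'$a - s$i$a"
begin

text \<open>Off \<open>k\<close> the target has a zero in one row; \<open>i\<close> records in which
  row the mass must go, so the two values of \<open>i\<close> are the two opposite ways of being
  wrong.\<close>

definition bad :: "2 \<Rightarrow> real^'n^2 \<Rightarrow> 'n set" where
  "bad i x = {j. j \<noteq> k \<and> z$i$j = 0 \<and> 0 < x$i$j}"

text \<open>A pivot that does not repair a bad column for good must drive column \<open>k\<close> to a bound while
  both kinds of bad columns are present. Column \<open>k\<close> is touched again only once one kind has
  disappeared, so the indicator pays for this pivot.\<close>

definition potential :: "real^'n^2 \<Rightarrow> nat" where
  "potential x = card (\<Union>i. bad i x) + of_bool (fractional x k \<and> (\<forall>i. bad i x \<noteq> {}))"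

lemma zP: "z \<in> P"
  using z by (rule vertex_in_P)

lemma z_zero: "j \<noteq> k \<Longrightarrow> \<exists>i. z$i$j = 0"
  using z_nf[of j] not_fractional[OF zP, of 1 2 j] by auto

lemma z_not_both_zero: "i \<noteq> i' \<Longrightarrow> z$i$j = 0 \<Longrightarrow> z$i'$j \<noteq> 0"
  using P_col[OF zP, of i i' j] v_pos[of j] by auto

text \<open>Column \<open>k\<close> is never bad, which leaves room for the indicator.\<close>

lemma potential_le: "potential x \<le> CARD('n)"
proof -
  have "card (\<Union>i. bad i x) \<le> card (UNIV - {k})"
    by (intro card_mono) (auto simp: bad_def)
  moreover have "0 < CARD('n)" by simp
  ultimately have "card (\<Union>i. bad i x) + 1 \<le> CARD('n)"
    unfolding card_Diff_singleton[OF UNIV_I] by linarith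
  then show ?thesis by (auto simp: potential_def of_bool_def)
qed

text \<open>The assumptions put row \<open>i'\<close> of \<open>x\<close> entrywise below that of
  \<open>z\<close>. A column in \<open>bad i x\<close> would make one inequality strict,
  contradicting the equal row sums.\<close>

lemma bad_empty:
  assumes "x \<in> P" "i \<noteq> i'" "bad i' x = {}" "x$i'$k = 0"
  shows "bad i x = {}"
proof (rule ccontr)
  assume "bad i x \<noteq> {}"
  then obtain a where a: "a \<noteq> k" "z$i$a = 0" "0 < x$i$a" by (auto simp: bad_def)
  have le: "x$i'$j \<le> z$i'$j" for j
  proof (cases "j = k")
    case False
    show ?thesis
    proof (cases "z$i'$j = 0")
      case True
      then show ?thesis using assms(3) False by (force simp: bad_def)
    next
      case False
      then have "z$i$j = 0" using z_zero[OF \<open>j \<noteq> k\<close>] other_row[OF \<open>i \<noteq> i'\<close>] by metis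
      then show ?thesis
        using P_col[OF zP \<open>i \<noteq> i'\<close>, of j] P_col[OF assms(1,2), of j] P_nonneg[OF assms(1), of i j]
        by simp
    qed
  qed (use assms P_nonneg[OF zP] in simp)
  have "x$i'$a < z$i'$a"
    using P_col[OF zP \<open>i \<noteq> i'\<close>, of a] P_col[OF assms(1,2), of a] a by simp
  then have "(\<Sum>j\<in>UNIV. x$i'$j) < (\<Sum>j\<in>UNIV. z$i'$j)"
    using le by (intro sum_strict_mono_ex1) auto
  then show False using P_row[OF zP] P_row[OF assms(1)] by simp
qed

lemma eq_target:
  assumes "x \<in> P" "\<And>i. bad i x = {}"
  shows "x = z"
proof (rule P_eqI[OF assms(1) zP, of k 1])
  fix j assume "j \<noteq> k"
  then obtain i where i: "z$i$j = 0" using z_zero by blast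
  then have "x$i$j = 0"
    using assms(2)[of i] \<open>j \<noteq> k\<close> P_nonneg[OF assms(1), of i j] by (auto simp: bad_def less_le)
  then show "x$1$j = z$1$j"
    using i P_col[OF zP, of i 1 j] P_col[OF assms(1), of i 1 j] by (cases "i = 1") auto
qed

text \<open>Column \<open>a\<close> loses mass in row \<open>i\<close> and \<open>b\<close> in row
  \<open>i'\<close>, exactly where bad columns have too much, so no new bad column arises. Either a
  bad entry is emptied, or \<open>k\<close> reaches a bound and the indicator drops.\<close>

lemma pivot_to_target:
  assumes x: "x extreme_point_of P" and ii: "i \<noteq> i'" and a: "a \<in> bad i x"
    and b: "b \<in> bad i' x \<or> b = k \<and> 0 < x$i'$k \<and> (fractional x k \<or> bad i' x = {})"
    and nf: "\<And>j. j \<noteq> a \<Longrightarrow> j \<noteq> b \<Longrightarrow> \<not> fractional x j"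
  shows "\<exists>x'. x' extreme_point_of P \<and> skeleton_adj P x x' \<and> s \<bullet> x \<le> s \<bullet> x' \<and>
    potential x' < potential x"
proof -
  have ab: "a \<noteq> b" using a b z_not_both_zero[OF ii] by (auto simp: bad_def)
  have pos: "0 < x$i$a" "0 < x$i'$b" using a b by (auto simp: bad_def)
  obtain x' t where x': "x' extreme_point_of P" "skeleton_adj P x x'"
    and t: "0 < t" "x' = x + t *\<^sub>R pivot_dir i a b"
    and off: "\<And>j r. j \<noteq> a \<Longrightarrow> j \<noteq> b \<Longrightarrow> x'$r$j = x$r$j"
    and zero: "x'$i$a = 0 \<or> x'$i'$b = 0"
    using pivot[OF x ii ab pos nf] by blast
  have x'P: "x' \<in> P" using x'(1) by (rule vertex_in_P)
  have cost_a: "s$i'$k - s$i$k \<le> s$i'$a - s$i$a"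
    using z_opt[OF ii] a by (simp add: bad_def)
  have "s$i$k - s$i'$k \<le> s$i$b - s$i'$b"
    using z_opt[of i' i b] ii b by (auto simp: bad_def)
  with cost_a have "0 \<le> s \<bullet> pivot_dir i a b"
    unfolding inner_pivot_dir[OF ii] by simp
  then have mono: "s \<bullet> x \<le> s \<bullet> x'" using t by (simp add: inner_add_right)
  have sub: "bad r x' \<subseteq> bad r x" for r
  proof
    fix j assume j: "j \<in> bad r x'"
    consider "j \<noteq> a" "j \<noteq> b" | "j = a" | "j = b" by blast
    then show "j \<in> bad r x"
    proof cases
      case 1
      then show ?thesis using j off by (simp add: bad_def)
    next
      case 2
      then have "r \<noteq> i'" using j a z_not_both_zero[OF ii] by (auto simp: bad_def)
      then show ?thesis using 2 a other_row[OF ii, of r] by auto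
    next
      case 3
      then have b': "b \<in> bad i' x" using j b by (auto simp: bad_def)
      then have "r \<noteq> i" using 3 j z_not_both_zero[OF ii] by (auto simp: bad_def)
      then show ?thesis using 3 b' other_row[OF ii, of r] by auto
    qed
  qed
  then have Un_sub: "(\<Union>r. bad r x') \<subseteq> (\<Union>r. bad r x)" by blast
  \<comment> \<open>This covers the exchanges that empty a bad entry: the set of bad columns shrinks
    strictly, and \<open>fr\<close> keeps the indicator from rising.\<close>
  have removed: "potential x' < potential x"
    if c: "c \<in> bad r x" "x'$r$c = 0" and fr: "fractional x' k \<Longrightarrow> \<forall>r. bad r x' \<noteq> {} \<Longrightarrow> fractional x k"
    for c r
  proof -
    have "c \<notin> bad q x'" for q
    proof (cases "q = r")
      case True
      then show ?thesis using c by (simp add: bad_def)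
    next
      case False
      then show ?thesis using c z_not_both_zero[of r q c] by (auto simp: bad_def)
    qed
    then have "c \<in> (\<Union>r. bad r x) - (\<Union>r. bad r x')" using c(1) by blast
    then have "(\<Union>r. bad r x') \<noteq> (\<Union>r. bad r x)" by force
    then have "card (\<Union>r. bad r x') < card (\<Union>r. bad r x)"
      by (intro psubset_card_mono[OF finite] psubsetI Un_sub)
    moreover have "fractional x k \<and> (\<forall>i. bad i x \<noteq> {})" if "fractional x' k \<and> (\<forall>i. bad i x' \<noteq> {})"
    proof -
      have "bad i x \<noteq> {}" for i using that sub[of i] by (metis subset_empty)
      then show ?thesis using that fr by simp
    qed
    ultimately show ?thesis
      unfolding potential_def by (intro add_less_le_mono) (simp_all add: of_bool_def)
  qed
  have "potential x' < potential x"
  proof (cases "b = k")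
    case False
    then have b': "b \<in> bad i' x" using b by simp
    have "fractional x' k \<longleftrightarrow> fractional x k"
      using off[of k] False a by (auto simp: fractional_def bad_def)
    with zero a b' show ?thesis using removed by blast
  next
    case True
    then have b': "fractional x k \<or> bad i' x = {}" using b by (auto simp: bad_def)
    show ?thesis
    proof (cases "x'$i$a = 0")
      case True
      with a b' sub[of i'] show ?thesis by (intro removed[of a i]) auto
    next
      \<comment> \<open>Column \<open>k\<close> reaches its bound first and \<open>a\<close> stays
        bad. By \<open>bad_empty\<close> the opposite kind is present as well, so the indicator was
        1 before and is 0 now.\<close>
      case nz: False
      then have k0: "x'$i'$k = 0" using zero True by simp
      have "0 < x'$i$a" using nz P_nonneg[OF x'P, of i a] by simp
      then have "a \<in> bad i x'" using a by (simp add: bad_def)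
      then have "bad i' x' \<noteq> {}" using bad_empty[OF x'P ii _ k0] by auto
      then have "bad i' x \<noteq> {}" using sub by blast
      then have "fractional x k \<and> (\<forall>r. bad r x \<noteq> {})"
        using b' a other_row[OF ii] by (metis empty_iff)
      moreover have "\<not> fractional x' k" using k0 not_fractional[OF x'P ii] by simp
      moreover have "card (\<Union>r. bad r x') \<le> card (\<Union>r. bad r x)"
        using Un_sub by (intro card_mono) auto
      ultimately show ?thesis unfolding potential_def by simp
    qed
  qed
  with x' mono show ?thesis by blast
qed

text \<open>If \<open>k\<close> is fractional, it can be paired with any bad column. Otherwise the
  exchange starts from a bad column carrying the fractional entries, if there are any, and its
  partner is an oppositely bad column or, failing that, \<open>k\<close>.\<close>

lemma step:
  assumes x: "x extreme_point_of P" and "x \<noteq> z"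
  shows "\<exists>x'. x' extreme_point_of P \<and> skeleton_adj P x x' \<and> s \<bullet> x \<le> s \<bullet> x' \<and>
    potential x' < potential x"
proof -
  have xP: "x \<in> P" using x by (rule vertex_in_P)
  obtain f where f: "\<And>j. j \<noteq> f \<Longrightarrow> \<not> fractional x j"
    using x by (rule vertexE) blast
  obtain a0 i0 where a0: "a0 \<in> bad i0 x" using eq_target[OF xP] assms(2) by blast
  show ?thesis
  proof (cases "fractional x k")
    case True
    have "i0 \<noteq> i0 + 1" by simp
    moreover from True have "\<not> fractional x j" if "j \<noteq> k" for j
      using f that by metis
    ultimately show ?thesis
      using a0 True by (intro pivot_to_target[OF x, of i0 "i0 + 1" a0 k]) (auto simp: fractional_def)
  next
    case False
    have "\<exists>a i. a \<in> bad i x \<and> (\<forall>j. j \<noteq> a \<longrightarrow> \<not> fractional x j)"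
    proof (cases "fractional x f")
      case True
      \<comment> \<open>A fractional column other than \<open>k\<close> has mass in both rows, hence
        is bad in whichever row \<open>z\<close> vanishes.\<close>
      then have "f \<noteq> k" using False by auto
      then obtain i where "z$i$f = 0" using z_zero by blast
      with True \<open>f \<noteq> k\<close> have "f \<in> bad i x" by (simp add: bad_def fractional_def)
      with f show ?thesis by blast
    next
      case False
      with f a0 show ?thesis by metis
    qed
    then obtain a i where a: "a \<in> bad i x" and nf: "\<And>j. j \<noteq> a \<Longrightarrow> \<not> fractional x j" by blast
    have ii: "i \<noteq> i + 1" by simp
    show ?thesis
    proof (cases "bad (i + 1) x = {}")
      case True
      \<comment> \<open>Here \<open>bad_empty\<close> supplies the mass that \<open>k\<close> has to
        give up.\<close>
      then have "x$(i + 1)$k \<noteq> 0" using bad_empty[OF xP ii] a by blast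
      then have "0 < x$(i + 1)$k" using P_nonneg[OF xP, of "i + 1" k] by simp
      with True a nf show ?thesis by (intro pivot_to_target[OF x ii a, of k]) auto
    next
      case False
      then obtain b where "b \<in> bad (i + 1) x" by blast
      with a nf show ?thesis by (intro pivot_to_target[OF x ii a, of b]) auto
    qed
  qed
qed

text \<open>The strictly falling potential bounds the length and excludes repeated vertices; the
  last conjunct carries the latter through the induction.\<close>

lemma monotone_walk_potential:
  assumes "x extreme_point_of P"
  shows "\<exists>xs. edge_walk P xs \<and> hd xs = x \<and> last xs = z \<and> walk_length xs \<le> potential x \<and>
    sorted (map (\<lambda>y. s \<bullet> y) xs) \<and> (\<forall>y\<in>set xs. potential y \<le> potential x)"
  using assms
proof (induction "potential x" arbitrary: x rule: less_induct)
  case less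
  show ?case
  proof (cases "x = z")
    case True
    then show ?thesis
      using less.prems by (intro exI[of _ "[x]"]) (simp add: edge_walk_def walk_length_def)
  next
    case False
    obtain x' where x': "x' extreme_point_of P" "skeleton_adj P x x'" "s \<bullet> x \<le> s \<bullet> x'"
      "potential x' < potential x"
      using step[OF less.prems False] by blast
    obtain xs where xs: "edge_walk P xs" "hd xs = x'" "last xs = z" "walk_length xs \<le> potential x'"
      "sorted (map (\<lambda>y. s \<bullet> y) xs)" "\<forall>y\<in>set xs. potential y \<le> potential x'"
      using less.hyps[OF x'(4,1)] by blast
    have ne: "xs \<noteq> []" using xs(1) by (simp add: edge_walk_def)
    then obtain ys where ys: "xs = x' # ys" using xs(2) by (cases xs) auto
    have "x \<notin> set xs" using xs(6) x'(4) by auto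
    moreover have "\<forall>y\<in>set xs. s \<bullet> x \<le> s \<bullet> y"
      using xs(5) x'(3) by (auto simp: ys)
    ultimately show ?thesis
      using xs x' less.prems ne
      by (intro exI[of _ "x # xs"])
        (auto simp: edge_walk_def walk_length_def successively_Cons)
  qed
qed

end

section \<open>Upper bound on the diameter\<close>

context transport
begin

lemma monotone_walk:
  assumes "z extreme_point_of P" "is_arg_max (\<lambda>y. s \<bullet> y) (\<lambda>y. y \<in> P) z" "x extreme_point_of P"
  shows "\<exists>xs. edge_walk P xs \<and> hd xs = x \<and> last xs = z \<and> walk_length xs \<le> CARD('n) \<and>
    sorted (map (\<lambda>y. s \<bullet> y) xs)"
proof -
  obtain k where k: "\<And>j. j \<noteq> k \<Longrightarrow> \<not> fractional z j"
    "\<And>i i' a. i \<noteq> i' \<Longrightarrow> z$i$a = 0 \<Longrightarrow> s$i'$k - s$i$k \<le> s$i'$a - s$i$a"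
    using break_column[OF assms(1,2)] by blast
  interpret transport_target u v s z k
    using assms k by unfold_locales auto
  show ?thesis
    using monotone_walk_potential[OF assms(3)] potential_le[of x] le_trans by blast
qed

text \<open>The maximizers form a nonempty compact face, and an extreme point of a face is a vertex
  of \<open>P\<close>.\<close>

lemma maximal_vertex_exists:
  assumes "P \<noteq> {}"
  obtains z where "z extreme_point_of P" "is_arg_max (\<lambda>y. s \<bullet> y) (\<lambda>y. y \<in> P) z"
proof -
  have "continuous_on P (\<lambda>y. s \<bullet> y)" by (intro continuous_intros)
  from continuous_attains_sup[OF compact_P assms this]
  obtain m where m: "m \<in> P" "\<And>y. y \<in> P \<Longrightarrow> s \<bullet> y \<le> s \<bullet> m" by blast
  define F where "F = P \<inter> {y. s \<bullet> y = s \<bullet> m}"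
  have F: "F face_of P"
    unfolding F_def using m convex_P by (intro face_of_Int_supporting_hyperplane_le) auto
  have "compact F" using face_of_imp_compact[OF convex_P compact_P F] .
  moreover have "F \<noteq> {}" using m by (auto simp: F_def)
  ultimately obtain z where z: "z extreme_point_of F"
    using extreme_point_exists_convex[of F] face_of_imp_convex[OF F] by blast
  then have "z \<in> F" by (simp add: extreme_point_of_def)
  moreover have "z extreme_point_of P" using z F extreme_point_of_face by blast
  ultimately show ?thesis
    using m by (intro that[of z]) (auto simp: F_def is_arg_max_def not_less)
qed

lemma graph_diameter_le: "graph_diameter P \<le> enat CARD('n)"
proof -
  have "graph_dist P x y \<le> enat CARD('n)"
    if x: "x extreme_point_of P" and y: "y extreme_point_of P" for x y
  proof -
    \<comment> \<open>Every vertex maximizes the zero objective.\<close>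
    have "is_arg_max (\<lambda>w. 0 \<bullet> w) (\<lambda>w. w \<in> P) y"
      using vertex_in_P[OF y] by (simp add: is_arg_max_def)
    from monotone_walk[OF y this x] obtain xs where
      "edge_walk P xs" "hd xs = x" "last xs = y" "walk_length xs \<le> CARD('n)" by blast
    then show ?thesis
      unfolding graph_dist_def by (intro INF_lower2[of xs]) auto
  qed
  then show ?thesis unfolding graph_diameter_def by (intro SUP_least) auto
qed

section \<open>Columns that change along an edge\<close>

text \<open>At the midpoint the exchange between \<open>a\<close> and \<open>b\<close> runs both
  ways inside \<open>P\<close>. The face property keeps it on the edge, so \<open>x' - x\<close> is
  a multiple of \<open>pivot_dir 1 a b\<close>.\<close>

lemma edge_direction:
  assumes adj: "skeleton_adj P x x'" and "a \<noteq> b"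
    and frac: "fractional (midpoint x x') a" "fractional (midpoint x x') b"
  shows "x'$1$j \<noteq> x$1$j \<longleftrightarrow> j = a \<or> j = b"
proof -
  let ?m = "midpoint x x'"
  have F: "closed_segment x x' face_of P" using adj by (simp add: skeleton_adj_def edge_of_def)
  have "?m \<in> closed_segment x x'" by simp
  then have "?m \<in> P" using face_of_imp_subset[OF F] by blast
  then obtain t where t: "0 < t" "?m + t *\<^sub>R pivot_dir 1 a b \<in> P" "?m - t *\<^sub>R pivot_dir 1 a b \<in> P"
    "?m \<in> open_segment (?m + t *\<^sub>R pivot_dir 1 a b) (?m - t *\<^sub>R pivot_dir 1 a b)"
    using pivot_open_segment \<open>a \<noteq> b\<close> frac by metis
  then have "?m + t *\<^sub>R pivot_dir 1 a b \<in> closed_segment x x'"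
    using face_ofD[OF F t(4)] by auto
  then obtain r where "?m + t *\<^sub>R pivot_dir 1 a b = (1 - r) *\<^sub>R x + r *\<^sub>R x'"
    by (auto simp: in_segment)
  then have "(?m + t *\<^sub>R pivot_dir 1 a b)$1$i = ((1 - r) *\<^sub>R x + r *\<^sub>R x')$1$i" for i
    by simp
  \<comment> \<open>The offset \<open>r - 1/2\<close> measures the displacement from the midpoint,
    which has parameter \<open>1/2\<close>.\<close>
  then have dir: "t * pivot_dir 1 a b $1$i = (r - 1/2) * (x'$1$i - x$1$i)" for i
    unfolding midpoint_def
    by (simp add: add_divide_distrib divide_inverse[symmetric])
      (simp add: field_simps)
  have "t = (r - 1/2) * (x'$1$b - x$1$b)"
    using dir[of b] \<open>a \<noteq> b\<close> by (simp add: pivot_dir_nth)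
  then have "r - 1/2 \<noteq> 0" using t(1) by (metis less_irrefl mult_zero_left)
  then have "x'$1$j \<noteq> x$1$j \<longleftrightarrow> pivot_dir 1 a b $1$j \<noteq> 0"
    using dir[of j] t(1) by auto
  then show ?thesis using \<open>a \<noteq> b\<close> by (auto simp: pivot_dir_nth)
qed

text \<open>A column that is fractional at an end or changes along the edge is fractional at the
  midpoint. Two such columns besides \<open>f\<close> would give the edge two different
  directions.\<close>

lemma edge_columns:
  assumes adj: "skeleton_adj P x x'" and f: "fractional x f" and P: "x \<in> P" "x' \<in> P"
  obtains g where "\<And>j. fractional x' j \<or> x'$1$j \<noteq> x$1$j \<Longrightarrow> j = f \<or> j = g"
proof -
  let ?m = "midpoint x x'"
  have m: "?m$i$j = (x$i$j + x'$i$j) / 2" for i j by (simp add: midpoint_def)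
  have frac: "fractional ?m j" if "fractional x j \<or> fractional x' j \<or> x'$1$j \<noteq> x$1$j" for j
    unfolding fractional_def m
  proof
    fix i
    have "x'$i$j \<noteq> x$i$j" if "x'$1$j \<noteq> x$1$j"
      using that P_col[OF P(1), of 1 i j] P_col[OF P(2), of 1 i j] by (cases "i = 1") auto
    then have "0 < x$i$j \<or> 0 < x'$i$j"
      using that P_nonneg[OF P(1), of i j] P_nonneg[OF P(2), of i j] by (auto simp: fractional_def)
    then show "0 < (x$i$j + x'$i$j) / 2"
      using P_nonneg[OF P(1), of i j] P_nonneg[OF P(2), of i j] by auto
  qed
  have "b = c" if "fractional ?m b" "fractional ?m c" "b \<noteq> f" "c \<noteq> f" for b c
    using edge_direction[OF adj, of f b b] edge_direction[OF adj, of f c b] frac[of f] f that by metis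
  then show ?thesis using frac that by metis
qed

end

text \<open>The non-degenerate case: along an edge one new column becomes fractional or switches between
  its bounds. If \<open>k\<close> is the narrowest column, then no other column switches while \<open>k\<close> stays
  fractional, so leaving \<open>k\<close> and coming back costs one extra step.\<close>

locale transport_narrow = transport u v
  for u :: "real^2" and v :: "real^'n::finite" +
  fixes z :: "real^'n^2" and k :: 'n
  assumes nondegenerate: "x extreme_point_of P \<Longrightarrow> \<exists>j. fractional x j"
    and z: "z extreme_point_of P" and z_k: "fractional z k"
    and narrow: "v$k \<le> v$j"
begin

text \<open>A lower bound for the distance to \<open>z\<close>; the indicator charges for leaving
  the fractional column \<open>k\<close> and coming back.\<close>

definition lower_potential :: "real^'n^2 \<Rightarrow> nat" where
  "lower_potential x = card {j. j \<noteq> k \<and> x$1$j \<noteq> z$1$j} + of_bool (fractional x k \<and> x \<noteq> z)"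

text \<open>If \<open>k\<close> is fractional at \<open>x\<close> and \<open>x\<close> is not
  \<open>z\<close>, no wrong column is corrected and only the indicator can drop. Otherwise the
  indicator is 0 at \<open>x\<close>, and at most one wrong column is corrected.\<close>

lemma lower_potential_edge:
  assumes x: "x extreme_point_of P" and x': "x' extreme_point_of P" and adj: "skeleton_adj P x x'"
  shows "lower_potential x \<le> Suc (lower_potential x')"
proof -
  define D where "D y = {j. j \<noteq> k \<and> y$1$j \<noteq> z$1$j}" for y :: "real^'n^2"
  have P: "x \<in> P" "x' \<in> P" "z \<in> P" using x x' z vertex_in_P by auto
  obtain f where f: "fractional x f" using nondegenerate[OF x] by blast
  obtain f' where f': "fractional x' f'" using nondegenerate[OF x'] by blast
  obtain g where g: "\<And>j. fractional x' j \<or> x'$1$j \<noteq> x$1$j \<Longrightarrow> j = f \<or> j = g"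
    using edge_columns[OF adj f P(1,2)] by blast
  have z_nf: "\<not> fractional z j" if "j \<noteq> k" for j
    using z z_k that unfolding vertex_iff by metis
  have frac_D: "j \<in> D y" if "fractional y j" "j \<noteq> k" "y \<in> P" for j y
  proof -
    have "fractional z j" if "y$1$j = z$1$j"
      using \<open>fractional y j\<close> that P_col[OF \<open>y \<in> P\<close> one_neq_two, of j] P_col[OF P(3) one_neq_two, of j]
      unfolding fractional_def forall_2 by linarith
    then show ?thesis using that z_nf[of j] by (auto simp: D_def)
  qed
  have unique: "j = f" if "fractional x j" for j
    using x f that unfolding vertex_iff by metis
  have unique': "j = f'" if "fractional x' j" for j
    using x' f' that unfolding vertex_iff by metis
  show ?thesis
  proof (cases "f = k")
    case True
    show ?thesis
    proof (cases "x = z")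
      case True
      then show ?thesis by (simp add: lower_potential_def)
    next
      case False
      have "D x \<subseteq> D x'"
      proof
        fix j assume j: "j \<in> D x"
        show "j \<in> D x'"
        proof (cases "x'$1$j = x$1$j")
          case True
          then show ?thesis using j by (simp add: D_def)
        next
          case ne: False
          then have "j = g" "g \<noteq> k" using g[of j] j \<open>f = k\<close> by (auto simp: D_def)
          \<comment> \<open>If \<open>k\<close> stayed fractional, \<open>g\<close> would switch
            between 0 and \<open>v$g\<close>, while \<open>k\<close> can absorb only less than
            \<open>v$k\<close>, which is at most \<open>v$g\<close>.\<close>
          have "f' = g"
          proof (rule ccontr)
            assume "f' \<noteq> g"
            then have "f' = k" using g[of f'] f' \<open>f = k\<close> by auto
            have rest: "x'$1$i = x$1$i" if "i \<noteq> k" "i \<noteq> g" for i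
              using g[of i] that \<open>f = k\<close> by auto
            have split: "(\<Sum>j\<in>UNIV. y$1$j) = y$1$k + y$1$g + (\<Sum>j\<in>UNIV - {k} - {g}. y$1$j)"
              for y :: "real^'n^2"
              using \<open>g \<noteq> k\<close> by (simp add: sum.remove[of UNIV k] sum.remove[of "UNIV - {k}" g])
            have "(\<Sum>j\<in>UNIV - {k} - {g}. x'$1$j) = (\<Sum>j\<in>UNIV - {k} - {g}. x$1$j)"
              using rest by (intro sum.cong) auto
            then have total: "x'$1$k + x'$1$g = x$1$k + x$1$g"
              using split[of x] split[of x'] P_row[OF P(1), of 1] P_row[OF P(2), of 1] by simp
            have "\<not> fractional x g" "\<not> fractional x' g"
              using unique unique' \<open>g \<noteq> k\<close> \<open>f = k\<close> \<open>f' = k\<close> by auto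
            then have "{x$1$g, x'$1$g} = {0, v$g}"
              using ne \<open>j = g\<close> not_fractional[OF P(1), of 1 2 g] not_fractional[OF P(2), of 1 2 g]
                P_col[OF P(1), of 1 2 g] P_col[OF P(2), of 1 2 g] by auto
            moreover have "0 < x$1$k" "x$1$k < v$k" "0 < x'$1$k" "x'$1$k < v$k"
              using f f' P_col[OF P(1), of 1 2 k] P_col[OF P(2), of 1 2 k] \<open>f = k\<close> \<open>f' = k\<close>
              by (simp_all add: fractional_def forall_2)
            ultimately show False
              using total narrow[of g] by (auto simp: doubleton_eq_iff)
          qed
          then show ?thesis using frac_D[OF f' _ P(2)] \<open>j = g\<close> \<open>g \<noteq> k\<close> by simp
        qed
      qed
      then have "card (D x) \<le> card (D x')" by (intro card_mono) auto
      then show ?thesis by (simp add: lower_potential_def D_def[symmetric] of_bool_def)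
    qed
  next
    case False
    \<comment> \<open>Only \<open>f\<close> and \<open>g\<close> can be corrected. If
      \<open>g\<close> is wrong at \<open>x\<close>, then \<open>f'\<close> is one of these two and
      stays wrong, being fractional and different from \<open>k\<close>.\<close>
    have "\<exists>h. D x \<subseteq> insert h (D x')"
    proof (cases "g \<in> D x")
      case True
      then have "g \<noteq> k" by (simp add: D_def)
      then have "f' \<in> D x'" "f' = f \<or> f' = g"
        using g[of f'] f' False frac_D[OF f' _ P(2)] by auto
      moreover have "D x \<subseteq> insert f (insert g (D x'))"
      proof
        fix j assume "j \<in> D x"
        with g[of j] show "j \<in> insert f (insert g (D x'))" by (cases "x'$1$j = x$1$j") (auto simp: D_def)
      qed
      ultimately show ?thesis by blast
    next
      case False
      have "D x \<subseteq> insert f (D x')"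
      proof
        fix j assume "j \<in> D x"
        with False g[of j] show "j \<in> insert f (D x')" by (auto simp: D_def)
      qed
      then show ?thesis by blast
    qed
    then obtain h where "D x \<subseteq> insert h (D x')" by blast
    then have "card (D x) \<le> card (insert h (D x'))" by (intro card_mono) auto
    then have "card (D x) \<le> Suc (card (D x'))"
      using card_insert_le_m1[of "Suc (card (D x'))" "D x'" h] by simp
    moreover have "\<not> fractional x k" using unique False by blast
    ultimately show ?thesis by (simp add: lower_potential_def D_def[symmetric])
  qed
qed

lemma walk_length_ge:
  assumes "edge_walk P xs" "last xs = z"
  shows "lower_potential (hd xs) \<le> walk_length xs"
proof -
  have "xs \<noteq> []" "\<forall>x\<in>set xs. x extreme_point_of P" "successively (skeleton_adj P) xs"
    using assms(1) by (auto simp: edge_walk_def)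
  then have "lower_potential (hd xs) \<le> walk_length xs"
    using assms(2)
  proof (induction xs rule: induct_list012)
    case (3 x x' xs)
    then have "lower_potential x' \<le> length xs" by (simp add: walk_length_def)
    moreover have "lower_potential x \<le> Suc (lower_potential x')"
      using 3 by (intro lower_potential_edge) auto
    ultimately show ?case by (simp add: walk_length_def)
  qed (simp_all add: lower_potential_def)
  then show ?thesis .
qed

lemma graph_diameter_ge:
  assumes y: "y extreme_point_of P" "fractional y k" and ne: "\<And>j. j \<noteq> k \<Longrightarrow> y$1$j \<noteq> z$1$j"
    and "y \<noteq> z"
  shows "enat CARD('n) \<le> graph_diameter P"
proof -
  have "{j. j \<noteq> k \<and> y$1$j \<noteq> z$1$j} = UNIV - {k}" using ne by auto
  \<comment> \<open>The \<open>n - 1\<close> wrong columns are counted together with the indicator,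
    which is 1 at \<open>y\<close>.\<close>
  then have "lower_potential y = CARD('n)"
    using assms by (simp add: lower_potential_def Suc_pred)
  then have "enat CARD('n) \<le> graph_dist P y z"
    unfolding graph_dist_def using walk_length_ge by (intro INF_greatest) force
  also have "\<dots> \<le> graph_diameter P"
    unfolding graph_diameter_def using y z by (intro SUP_upper2[of "(y, z)"]) auto
  finally show ?thesis .
qed

end

section \<open>An instance attaining the bound\<close>

lemma tight_transportation_polytope:
  assumes n: "3 \<le> CARD('n::finite)"
  shows "\<exists>P :: (real^'n^2) set. is_transportation_polytope P \<and> graph_diameter P = enat CARD('n)"
proof -
  obtain k a :: 'n where ka: "a \<noteq> k"
  proof -
    have "\<not> card (UNIV :: 'n set) \<le> Suc 0" using n by simp
    then show ?thesis using that unfolding card_le_Suc0_iff_eq[OF finite] by blast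
  qed
  \<comment> \<open>\<open>N\<close> counts the columns other than \<open>k\<close> and
    \<open>a\<close>; three columns give \<open>N\<close> at least 1, so that \<open>v$a\<close> is
    positive and not below \<open>v$k\<close>.\<close>
  define N where "N = CARD('n) - 2"
  have N: "1 \<le> N" using n by (simp add: N_def)
  define v :: "real^'n" where
    "v = (\<chi> j. if j = k then 1 else if j = a then 2 * real N else 2)"
  define u :: "real^2" where "u = (\<chi> i. 2 * real N + 1 / 2)"
  \<comment> \<open>Column \<open>a\<close> weighs as much as the \<open>N\<close> columns of size 2
    together. Hence row \<open>r\<close> can take \<open>a\<close> and the other row the rest, with
    \<open>k\<close> split evenly, and swapping the rows gives the opposite vertex.\<close>
  define w :: "2 \<Rightarrow> real^'n^2" where
    "w r = (\<chi> i j. if j = k then 1 / 2 else if (j = a) = (i = r) then v$j else 0)" for r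
  have u_nth: "u$i = 2 * real N + 1 / 2" for i by (simp add: u_def)
  have v_nth: "v$k = 1" "v$a = 2 * real N" "\<And>j. j \<noteq> k \<Longrightarrow> j \<noteq> a \<Longrightarrow> v$j = 2"
    using ka by (auto simp: v_def)
  interpret transport u v
    using N by unfold_locales (auto simp: u_def v_def)
  have card_rest: "card (UNIV - {k} - {a}) = N"
    using ka by (simp add: N_def card_Diff_singleton)
  have sum_split: "(\<Sum>j\<in>UNIV. f j) = f k + f a + (\<Sum>j\<in>UNIV - {k} - {a}. f j)" for f :: "'n \<Rightarrow> real"
    using ka by (simp add: sum.remove[of UNIV k] sum.remove[of "UNIV - {k}" a])
  have wP: "w r \<in> P" for r
  proof (rule P_I)
    show "(\<Sum>j\<in>UNIV. w r$i$j) = u$i" for i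
    proof -
      have "(\<Sum>j\<in>UNIV - {k} - {a}. w r$i$j) = (\<Sum>j\<in>UNIV - {k} - {a}. if i = r then 0 else 2)"
        by (intro sum.cong) (auto simp: w_def v_def)
      then show ?thesis
        unfolding sum_split[of "\<lambda>j. w r$i$j"] using ka card_rest by (auto simp: w_def u_nth v_nth)
    qed
    show "w r$1$j + w r$2$j = v$j" for j
      using exhaust_2[of r] by (auto simp: w_def v_nth)
    show "0 \<le> w r$i$j" for i j
      using v_pos[of j] by (simp add: w_def)
  qed
  have w_k: "fractional (w r) k" for r by (simp add: fractional_def w_def)
  have w_nf: "\<not> fractional (w r) j" if "j \<noteq> k" for r j
    using exhaust_2[of r] that by (auto simp: fractional_def forall_2 w_def)
  have w_vertex: "w r extreme_point_of P" for r
    unfolding vertex_iff using wP w_nf by metis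
  \<comment> \<open>Without a fractional column all entries would be integers, whereas the row sums
    are half-integral.\<close>
  have nondegenerate: "\<exists>j. fractional x j" if "x extreme_point_of P" for x
  proof (rule ccontr)
    assume "\<nexists>j. fractional x j"
    moreover have xP: "x \<in> P" using that by (rule vertex_in_P)
    ultimately have "x$1$j = 0 \<or> x$1$j = v$j" for j
      using not_fractional[OF xP, of 1 2 j] P_col[OF xP, of 1 2 j] by auto
    moreover have "v$j \<in> \<int>" for j by (simp add: v_def)
    ultimately have "x$1$j \<in> \<int>" for j by (metis Ints_0)
    then have "(\<Sum>j\<in>UNIV. x$1$j) \<in> \<int>" by (intro Ints_sum) auto
    then have "2 * real N + 1 / 2 \<in> \<int>" using P_row[OF xP, of 1] by (simp add: u_nth)
    then obtain m :: int where "2 * real N + 1 / 2 = of_int m" by (auto elim: Ints_cases)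
    then have "real_of_int (4 * int N + 1) = of_int (2 * m)" by simp
    then show False unfolding of_int_eq_iff by presburger
  qed
  interpret transport_narrow u v "w 2" k
    using nondegenerate w_vertex w_k N by unfold_locales (auto simp: v_def)
  have "w 1$1$j \<noteq> w 2$1$j" if "j \<noteq> k" for j
    using that v_pos[of j] by (auto simp: w_def)
  moreover from this[OF ka] have "w 1 \<noteq> w 2" by auto
  ultimately have "enat CARD('n) \<le> graph_diameter P"
    using w_vertex w_k by (intro graph_diameter_ge[of "w 1"]) auto
  then have "graph_diameter P = enat CARD('n)"
    using graph_diameter_le by (rule antisym[rotated])
  moreover have "(\<Sum>j\<in>UNIV. v$j) = u$1 + u$2"
    unfolding sum_split using card_rest by (simp add: u_nth v_nth)
  then have "is_transportation_polytope P"
    unfolding is_transportation_polytope_def using u_pos v_pos by metis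
  ultimately show ?thesis by blast
qed

theorem theorem3:
  shows "(\<forall>P :: (real^'n::finite^2) set. is_transportation_polytope P \<longrightarrow>
            (\<forall>(s :: real^'n^2) yO. yO extreme_point_of P \<longrightarrow>
               (\<exists>xs. edge_walk P xs \<and> hd xs = yO \<and> walk_length xs \<le> CARD('n) \<and>
                     is_arg_max (\<lambda>y. s \<bullet> y) (\<lambda>y. y \<in> P) (last xs) \<and>
                     sorted (map (\<lambda>y. s \<bullet> y) xs))) \<and>
            graph_diameter P \<le> enat CARD('n)) \<and>
         (3 \<le> CARD('n) \<longrightarrow>
            (\<exists>P :: (real^'n^2) set. is_transportation_polytope P \<and>
               graph_diameter P = enat CARD('n)))"
proof (intro conjI allI impI)
  fix P :: "(real^'n^2) set"
  assume "is_transportation_polytope P"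
  then obtain u v where uv: "\<forall>i. 0 < u$i" "\<forall>j. 0 < v$j" and P: "P = transportation_polytope u v"
    unfolding is_transportation_polytope_def by blast
  interpret transport u v using uv by unfold_locales auto
  show "graph_diameter P \<le> enat CARD('n)" using graph_diameter_le P by simp
  fix s yO :: "real^'n^2"
  assume "yO extreme_point_of P"
  then have yO: "yO extreme_point_of transportation_polytope u v" using P by simp
  then have "transportation_polytope u v \<noteq> {}" using vertex_in_P by blast
  then obtain z where z: "z extreme_point_of transportation_polytope u v"
    "is_arg_max (\<lambda>y. s \<bullet> y) (\<lambda>y. y \<in> transportation_polytope u v) z"
    by (rule maximal_vertex_exists)
  show "\<exists>xs. edge_walk P xs \<and> hd xs = yO \<and> walk_length xs \<le> CARD('n) \<and>
      is_arg_max (\<lambda>y. s \<bullet> y) (\<lambda>y. y \<in> P) (last xs) \<and> sorted (map (\<lambda>y. s \<bullet> y) xs)"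
    using monotone_walk[OF z yO] z(2) unfolding P by auto
qed (rule tight_transportation_polytope)

end
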